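(* Let $X$ be a finite nonempty set. (i) Every diamond-generating set of cover edges of the Boolean lattice $\mathcal{B}_X$ has cardinality at least $|X|$, and this bound is attained. (ii) For a graph $G$ on the vertex set $X$, the set $S_G=\{N_G(i)\to N_G(i)\cup\{i\}: i\in X\}$ diamond-generates $\mathcal{B}_X$ if and only if $G$ is a cograph. (iii) Every diamond-generating set of cover edges of $\mathcal{B}_X$ of cardinality $|X|$ is equal to $S_G$ for a unique cograph $G$ on $X$.
   Context: Graphs are finite, simple and undirected; $N_G(i)$ denotes the open neighborhood of the vertex $i$ in $G$ (so $i\notin N_G(i)$). For a finite set $X$, $\mathcal{B}_X=2^X$ is the Boolean lattice of subsets of $X$ ordered by inclusion. A cover edge of $\mathcal{B}_X$ is $e_i(A): A\to A\cup\{i\}$ with $i\in X$ and $A\subseteq X\setminus\{i\}$; $i$ is its direction. $E(\mathcal{B}_X)$ is the set of all cover edges. The set $S_G$ is thus $\{e_i(N_G(i)): i\in X\}$. A diamond is determined by $A\subseteq X$ and distinct $i,j\in X\setminus A$. Its lower half is $L(A;i,j)=\{e_i(A),e_j(A)\}$, its upper half is $U(A;i,j)=\{e_i(A\cup\{j\}),e_j(A\cup\{i\})\}$, and its four edges are $L(A;i,j)\cup U(A;i,j)$. Diamond closure: for $S\subseteq E(\mathcal{B}_X)$ let $S^{(0)}=S$ and let $S^{(t+1)}$ be $S^{(t)}$ together with all four edges of every diamond for which $L(A;i,j)\subseteq S^{(t)}$ or $U(A;i,j)\subseteq S^{(t)}$. The diamond closure of $S$ is $\operatorname{cl}_{\diamond,X}(S)=\bigcup_{t\ge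 0}S^{(t)}$ (equivalently, the smallest set of cover edges containing $S$ and closed under diamond completion). $S$ is diamond-generating (or diamond-generates $\mathcal{B}_X$) if $\operatorname{cl}_{\diamond,X}(S)=E(\mathcal{B}_X)$. The join $G_1\vee G_2$ is obtained from the disjoint union of $G_1$ and $G_2$ by adding every edge between their vertex sets. A cograph is a graph obtained from one-vertex graphs by repeated disjoint union and join (equivalently, a graph with no induced path on four vertices). *)

theory Defs
  imports "Graph_Theory.Pair_Digraph"
begin

text \<open>A cover edge is encoded as the pair of its endpoints, smaller set first.\<close>

type_synonym 'a edge = "'a set \<times> 'a set"

definition cover_edge :: "'a \<Rightarrow> 'a set \<Rightarrow> 'a edge" where
  "cover_edge i A = (A, A \<union> {i})"

definition cover_edges :: "'a set \<Rightarrow> 'a edge set" where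
  "cover_edges X = {cover_edge i A | i A. i \<in> X \<and> A \<subseteq> X - {i}}"

definition is_diamond :: "'a set \<Rightarrow> 'a set \<Rightarrow> 'a \<Rightarrow> 'a \<Rightarrow> bool" where
  "is_diamond X A i j \<longleftrightarrow> A \<subseteq> X \<and> i \<in> X - A \<and> j \<in> X - A \<and> i \<noteq> j"

definition lower_half :: "'a set \<Rightarrow> 'a \<Rightarrow> 'a \<Rightarrow> 'a edge set" where
  "lower_half A i j = {cover_edge i A, cover_edge j A}"

definition upper_half :: "'a set \<Rightarrow> 'a \<Rightarrow> 'a \<Rightarrow> 'a edge set" where
  "upper_half A i j = {cover_edge i (A \<union> {j}), cover_edge j (A \<union> {i})}"

definition diamond_step :: "'a set \<Rightarrow> 'a edge set \<Rightarrow> 'a edge set" where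
  "diamond_step X S = S \<union> \<Union>{lower_half A i j \<union> upper_half A i j | A i j.
     is_diamond X A i j \<and> (lower_half A i j \<subseteq> S \<or> upper_half A i j \<subseteq> S)}"

definition diamond_closure :: "'a set \<Rightarrow> 'a edge set \<Rightarrow> 'a edge set" where
  "diamond_closure X S = (\<Union>t. (diamond_step X ^^ t) S)"

definition diamond_generating :: "'a set \<Rightarrow> 'a edge set \<Rightarrow> bool" where
  "diamond_generating X S \<longleftrightarrow> S \<subseteq> cover_edges X \<and> diamond_closure X S = cover_edges X"

text \<open>
  Finite simple undirected graphs are the library's \<open>pair_graph\<close>s: finite symmetric loop-free
  digraphs without parallel arcs, in which an undirected edge is a pair of opposite arcs.
\<close>

definition nbhd :: "'a pair_pre_digraph \<Rightarrow> 'a \<Rightarrow> 'a set" where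
  "nbhd G i = {j. (i, j) \<in> parcs G}"

definition graph_edges :: "'a pair_pre_digraph \<Rightarrow> 'a edge set" where
  "graph_edges G = {cover_edge i (nbhd G i) | i. i \<in> pverts G}"

definition graph_union ::
  "'a pair_pre_digraph \<Rightarrow> 'a pair_pre_digraph \<Rightarrow> 'a pair_pre_digraph" where
  "graph_union G H = \<lparr>pverts = pverts G \<union> pverts H, parcs = parcs G \<union> parcs H\<rparr>"

definition graph_join ::
  "'a pair_pre_digraph \<Rightarrow> 'a pair_pre_digraph \<Rightarrow> 'a pair_pre_digraph" where
  "graph_join G H = \<lparr>pverts = pverts G \<union> pverts H,
     parcs = parcs G \<union> parcs H \<union> pverts G \<times> pverts H \<union> pverts H \<times> pverts G\<rparr>"

text \<open>
  Disjoint unions and joins are taken of graphs on disjoint vertex sets in the same type.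
  Every single vertex is admitted as a start, so no closure under isomorphism is needed.
\<close>

inductive cograph :: "'a pair_pre_digraph \<Rightarrow> bool" where
  single: "cograph \<lparr>pverts = {v}, parcs = {}\<rparr>"
| union: "\<lbrakk>cograph G; cograph H; pverts G \<inter> pverts H = {}\<rbrakk> \<Longrightarrow> cograph (graph_union G H)"
| join: "\<lbrakk>cograph G; cograph H; pverts G \<inter> pverts H = {}\<rbrakk> \<Longrightarrow> cograph (graph_join G H)"

lemma pair_graph_iff:
  "pair_graph G \<longleftrightarrow> finite (pverts G) \<and> parcs G \<subseteq> pverts G \<times> pverts G
     \<and> sym (parcs G) \<and> irrefl (parcs G)"
proof
  assume "pair_graph G"
  then interpret pair_graph G .
  show "finite (pverts G) \<and> parcs G \<subseteq> pverts G \<times> pverts G \<and> sym (parcs G) \<and> irrefl (parcs G)"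
    using pair_finite_verts in_arcsD1 in_arcsD2 arcs_symmetric no_loops'
    unfolding sym_def irrefl_def by (intro conjI subrelI allI impI notI) blast+
next
  assume *: "finite (pverts G) \<and> parcs G \<subseteq> pverts G \<times> pverts G
     \<and> sym (parcs G) \<and> irrefl (parcs G)"
  then have "finite (parcs G)" by (meson finite_SigmaI finite_subset)
  with * show "pair_graph G"
    by unfold_locales (auto simp: symmetric_def irrefl_def)
qed

lemma cograph_pair_graph: "cograph G \<Longrightarrow> pair_graph G"
proof (induction rule: cograph.induct)
  case (single v)
  show ?case by (simp add: pair_graph_iff sym_def irrefl_def)
next
  case (union G H)
  then show ?case
    by (auto simp: pair_graph_iff graph_union_def sym_def irrefl_def)
next
  case (join G H)
  then show ?case
    by (auto simp: pair_graph_iff graph_join_def sym_def irrefl_def)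
qed

lemma diamond_step_cover_edges:
  assumes "S \<subseteq> cover_edges X"
  shows "diamond_step X S \<subseteq> cover_edges X"
proof -
  have "lower_half A i j \<union> upper_half A i j \<subseteq> cover_edges X" if "is_diamond X A i j" for A i j
    using that unfolding lower_half_def upper_half_def cover_edges_def is_diamond_def
    by blast
  with assms show ?thesis unfolding diamond_step_def by blast
qed

lemma diamond_closure_cover_edges:
  assumes "S \<subseteq> cover_edges X"
  shows "diamond_closure X S \<subseteq> cover_edges X"
proof -
  have "(diamond_step X ^^ t) S \<subseteq> cover_edges X" for t
    by (induction t) (simp_all add: assms diamond_step_cover_edges)
  then show ?thesis unfolding diamond_closure_def by blast
qed

lemma graph_edges_cover_edges:
  assumes "pair_graph G"
  shows "graph_edges G \<subseteq> cover_edges (pverts G)"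
  using assms unfolding pair_graph_iff graph_edges_def cover_edges_def nbhd_def irrefl_def
  by blast

end

theory Submission
  imports Defs
begin

text \<open>
  The closure of \<open>S\<close> is the least diamond-closed set containing \<open>S\<close>, so \<open>S\<close> generates
  exactly when every diamond-closed set containing \<open>S\<close> contains all cover edges. All
  arguments are about closed sets and two ways of transporting them: into an interval
  \<open>[C, C \<union> Y]\<close> and back along the projection \<open>A \<mapsto> A \<inter> Y\<close>. In particular, the
  projection of a generating set generates (\<open>projection_covers\<close>).

  Each half of a diamond contains both of its directions, so completing diamonds never creates
  a new direction. A generating set therefore has an edge in each of the \<open>|X|\<close> directions, and
  the edges leaving the empty set show that \<open>|X|\<close> edges can suffice. A generating set of size
  \<open>|X|\<close> has exactly one edge \<open>N\<^sub>i \<rightarrow> N\<^sub>i \<union> {i}\<close> in each direction. Projected to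
  \<open>{i, j}\<close> it has two edges, which generate only if they form a half of the one diamond; this
  says that \<open>j \<in> N\<^sub>i\<close> if and only if \<open>i \<in> N\<^sub>j\<close>, so the sets \<open>N\<^sub>i\<close> are the
  neighbourhoods of a graph.

  The edges of a cograph generate by induction on its construction. In a disjoint union the
  edges of each part generate the subsets of that part, in particular all edges leaving the empty
  set, and these generate everything. A join is the same situation upside down: each part
  generates an interval that ends at the top.

  Conversely, if the edges of a graph with at least two vertices generate, then some diamond has
  a half among them, and this means that its two directions \<open>i\<close> and \<open>j\<close> are twins: they
  have the same neighbours apart from each other. Deleting \<open>j\<close> is a projection and preserves
  generation, so the smaller graph is a cograph by induction, and a twin added to a cograph
  yields a cograph.
\<close>

section \<open>Diamond-closed sets\<close>

definition diamond_closed :: "'a set \<Rightarrow> 'a edge set \<Rightarrow> bool" where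
  "diamond_closed X T \<longleftrightarrow> (\<forall>A i j. is_diamond X A i j \<longrightarrow>
     lower_half A i j \<subseteq> T \<or> upper_half A i j \<subseteq> T \<longrightarrow> lower_half A i j \<union> upper_half A i j \<subseteq> T)"

lemma diamond_closedI:
  assumes "\<And>A i j. is_diamond X A i j \<Longrightarrow> lower_half A i j \<subseteq> T \<longleftrightarrow> upper_half A i j \<subseteq> T"
  shows "diamond_closed X T"
  using assms unfolding diamond_closed_def by blast

lemma diamond_closedD:
  assumes "diamond_closed X T" "is_diamond X A i j"
  shows "lower_half A i j \<subseteq> T \<longleftrightarrow> upper_half A i j \<subseteq> T"
  using assms unfolding diamond_closed_def by blast

lemma subset_diamond_closure: "S \<subseteq> diamond_closure X S"
proof -
  have "(diamond_step X ^^ 0) S \<subseteq> diamond_closure X S"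
    unfolding diamond_closure_def by blast
  then show ?thesis by simp
qed

text \<open>
  The stages increase, so the two edges of a half already occur together at some stage.
\<close>

lemma diamond_closure_closed: "diamond_closed X (diamond_closure X S)"
proof -
  let ?F = "\<lambda>t. (diamond_step X ^^ t) S"
  have mono: "?F s \<subseteq> ?F t" if "s \<le> t" for s t
    by (rule lift_Suc_mono_le[OF _ that]) (auto simp: diamond_step_def)
  have pair: "\<exists>t. {e, f} \<subseteq> ?F t" if ef: "{e, f} \<subseteq> diamond_closure X S" for e f
  proof -
    obtain s t where "e \<in> ?F s" "f \<in> ?F t"
      using ef unfolding diamond_closure_def by blast
    then have "{e, f} \<subseteq> ?F (max s t)"
      using mono[of s "max s t"] mono[of t "max s t"] by auto
    then show ?thesis by blast
  qed
  have "lower_half A i j \<union> upper_half A i j \<subseteq> diamond_closure X S"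
    if d: "is_diamond X A i j"
      and h: "lower_half A i j \<subseteq> diamond_closure X S \<or> upper_half A i j \<subseteq> diamond_closure X S"
    for A i j
  proof -
    obtain t where "lower_half A i j \<subseteq> ?F t \<or> upper_half A i j \<subseteq> ?F t"
      using h pair unfolding lower_half_def upper_half_def by meson
    then have "lower_half A i j \<union> upper_half A i j \<subseteq> diamond_step X (?F t)"
      using d unfolding diamond_step_def by blast
    also have "\<dots> = ?F (Suc t)" by simp
    also have "\<dots> \<subseteq> diamond_closure X S" unfolding diamond_closure_def by blast
    finally show ?thesis .
  qed
  then show ?thesis unfolding diamond_closed_def by blast
qed

lemma diamond_closure_least:
  assumes "S \<subseteq> T" and "diamond_closed X T"
  shows "diamond_closure X S \<subseteq> T"
proof -
  have "(diamond_step X ^^ t) S \<subseteq> T" for t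
  proof (induction t)
    case 0
    then show ?case using assms(1) by simp
  next
    case (Suc t)
    have "diamond_step X ((diamond_step X ^^ t) S) \<subseteq> T"
    proof
      fix e assume "e \<in> diamond_step X ((diamond_step X ^^ t) S)"
      then consider "e \<in> (diamond_step X ^^ t) S"
        | A i j where "is_diamond X A i j" "e \<in> lower_half A i j \<union> upper_half A i j"
            "lower_half A i j \<subseteq> (diamond_step X ^^ t) S \<or> upper_half A i j \<subseteq> (diamond_step X ^^ t) S"
        unfolding diamond_step_def by blast
      then show "e \<in> T"
      proof cases
        case 1
        then show ?thesis using Suc by blast
      next
        case (2 A i j)
        with Suc have "lower_half A i j \<subseteq> T \<or> upper_half A i j \<subseteq> T" by blast
        with 2 assms(2) show ?thesis unfolding diamond_closed_def by blast
      qed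
    qed
    then show ?case by simp
  qed
  then show ?thesis unfolding diamond_closure_def by blast
qed

lemma diamond_generating_iff:
  "diamond_generating X S \<longleftrightarrow>
     S \<subseteq> cover_edges X \<and> (\<forall>T. S \<subseteq> T \<longrightarrow> diamond_closed X T \<longrightarrow> cover_edges X \<subseteq> T)"
proof
  assume "diamond_generating X S"
  then show "S \<subseteq> cover_edges X \<and> (\<forall>T. S \<subseteq> T \<longrightarrow> diamond_closed X T \<longrightarrow> cover_edges X \<subseteq> T)"
    using diamond_closure_least unfolding diamond_generating_def by blast
next
  assume *: "S \<subseteq> cover_edges X \<and> (\<forall>T. S \<subseteq> T \<longrightarrow> diamond_closed X T \<longrightarrow> cover_edges X \<subseteq> T)"
  then have "cover_edges X \<subseteq> diamond_closure X S"
    using subset_diamond_closure diamond_closure_closed by blast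
  with * show "diamond_generating X S"
    using diamond_closure_cover_edges unfolding diamond_generating_def by blast
qed

lemma cover_edge_in_cover_edges: "i \<in> X \<Longrightarrow> A \<subseteq> X - {i} \<Longrightarrow> cover_edge i A \<in> cover_edges X"
  unfolding cover_edges_def by blast

lemma cover_edge_eq_iff:
  "i \<notin> A \<Longrightarrow> k \<notin> B \<Longrightarrow> cover_edge i A = cover_edge k B \<longleftrightarrow> i = k \<and> A = B"
  unfolding cover_edge_def by blast


section \<open>Edges at the bottom or at the top of the lattice\<close>

text \<open>
  Lower halves propagate upwards: \<open>e\<^sub>i(A)\<close> and \<open>e\<^sub>j(A)\<close> give \<open>e\<^sub>i(A \<union> {j})\<close>, so the edges
  leaving the empty set reach every level.
\<close>

lemma bottom_edges_generate:
  assumes "finite X" and T: "diamond_closed X T" and bot: "\<And>i. i \<in> X \<Longrightarrow> cover_edge i {} \<in> T"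
  shows "cover_edges X \<subseteq> T"
proof -
  have "\<forall>i\<in>X - A. cover_edge i A \<in> T" if "finite A" "A \<subseteq> X" for A
    using that
  proof (induction A rule: finite_induct)
    case empty
    then show ?case using bot by simp
  next
    case (insert j A)
    show ?case
    proof
      fix i assume i: "i \<in> X - insert j A"
      then have d: "is_diamond X A i j"
        using insert by (auto simp: is_diamond_def)
      have "lower_half A i j \<subseteq> T"
        using insert i by (auto simp: lower_half_def)
      then have "upper_half A i j \<subseteq> T" using diamond_closedD[OF T d] by simp
      then show "cover_edge i (insert j A) \<in> T" by (simp add: upper_half_def)
    qed
  qed
  then show ?thesis
    using assms(1) finite_subset unfolding cover_edges_def by blast
qed

text \<open>Dually, upper halves propagate downwards; the induction is on the complement \<open>B\<close> of \<open>A \<union> {i}\<close>.\<close>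

lemma top_edges_generate:
  assumes "finite X" and T: "diamond_closed X T" and top: "\<And>i. i \<in> X \<Longrightarrow> cover_edge i (X - {i}) \<in> T"
  shows "cover_edges X \<subseteq> T"
proof -
  have *: "\<forall>i\<in>X - B. cover_edge i (X - B - {i}) \<in> T" if "finite B" "B \<subseteq> X" for B
    using that
  proof (induction B rule: finite_induct)
    case empty
    then show ?case using top by simp
  next
    case (insert j B)
    show ?case
    proof
      fix i assume i: "i \<in> X - insert j B"
      define A where "A = X - insert j B - {i}"
      have d: "is_diamond X A i j"
        using insert i by (auto simp: is_diamond_def A_def)
      have "A \<union> {j} = X - B - {i}" "A \<union> {i} = X - B - {j}"
        using insert i by (auto simp: A_def)
      then have "upper_half A i j \<subseteq> T"
        using insert i by (auto simp: upper_half_def)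
      then have "lower_half A i j \<subseteq> T" using diamond_closedD[OF T d] by simp
      then show "cover_edge i (X - insert j B - {i}) \<in> T" by (simp add: lower_half_def A_def)
    qed
  qed
  show ?thesis
  proof
    fix e assume "e \<in> cover_edges X"
    then obtain i A where e: "e = cover_edge i A" "i \<in> X" "A \<subseteq> X - {i}"
      unfolding cover_edges_def by blast
    have "X - (X - A - {i}) - {i} = A" "i \<in> X - (X - A - {i})" using e by auto
    moreover have "finite (X - A - {i})" "X - A - {i} \<subseteq> X" using assms(1) by auto
    ultimately show "e \<in> T" using * e(1) by metis
  qed
qed


section \<open>Intervals and projections\<close>

text \<open>
  The interval \<open>[C, C \<union> Y]\<close> is a copy of the lattice of \<open>Y\<close> whose diamonds are diamonds
  of \<open>X\<close>, so generation inside it is generation in the lattice of \<open>X\<close>.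
\<close>

lemma interval_generated:
  assumes gen: "diamond_generating Y S" and T: "diamond_closed X T"
    and Y: "Y \<subseteq> X" and C: "C \<subseteq> X" "Y \<inter> C = {}"
    and sub: "\<And>A B. (A, B) \<in> S \<Longrightarrow> (A \<union> C, B \<union> C) \<in> T"
    and i: "i \<in> Y" "A \<subseteq> Y - {i}"
  shows "cover_edge i (A \<union> C) \<in> T"
proof -
  let ?T = "{(A, B). (A \<union> C, B \<union> C) \<in> T}"
  have "diamond_closed Y ?T"
  proof (rule diamond_closedI)
    fix A i j assume "is_diamond Y A i j"
    then have "is_diamond X (A \<union> C) i j" using Y C by (auto simp: is_diamond_def)
    from diamond_closedD[OF T this]
    show "lower_half A i j \<subseteq> ?T \<longleftrightarrow> upper_half A i j \<subseteq> ?T"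
      by (simp add: lower_half_def upper_half_def cover_edge_def)
  qed
  moreover have "S \<subseteq> ?T" using sub by auto
  ultimately have "cover_edges Y \<subseteq> ?T"
    using gen unfolding diamond_generating_iff by blast
  then have "cover_edge i A \<in> ?T" using cover_edge_in_cover_edges[OF i] by (rule subsetD)
  then show ?thesis by (simp add: cover_edge_def)
qed

text \<open>
  Intersecting with \<open>Y\<close> sends a diamond of \<open>X\<close> to a diamond, to a single edge or to a
  point, according to how many of its two directions lie in \<open>Y\<close>. In each case the preimage of
  a closed set contains both halves or neither. The first disjunct collects the edges that collapse.
\<close>

lemma diamond_closed_projection:
  fixes X Y :: "'a set"
  assumes T: "diamond_closed Y T"
  shows "diamond_closed X {(A, B). A \<inter> Y = B \<inter> Y \<or> (A \<inter> Y, B \<inter> Y) \<in> T}" (is "diamond_closed X ?T")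
proof (rule diamond_closedI)
  fix A i j assume d: "is_diamond X A i j"
  show "lower_half A i j \<subseteq> ?T \<longleftrightarrow> upper_half A i j \<subseteq> ?T"
  proof (cases "i \<in> Y \<and> j \<in> Y")
    case True
    then have dY: "is_diamond Y (A \<inter> Y) i j" using d by (auto simp: is_diamond_def)
    have "i \<notin> A" "j \<notin> A" "i \<noteq> j" using d by (auto simp: is_diamond_def)
    moreover have "D \<noteq> insert x D" if "x \<notin> D" for x and D :: "'a set"
      using that by (metis insertI1)
    ultimately have "A \<inter> Y \<noteq> insert i (A \<inter> Y)" "A \<inter> Y \<noteq> insert j (A \<inter> Y)"
      "insert j (A \<inter> Y) \<noteq> insert i (insert j (A \<inter> Y))"
      "insert i (A \<inter> Y) \<noteq> insert j (insert i (A \<inter> Y))" by simp_all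
    with True diamond_closedD[OF T dY] show ?thesis
      by (simp add: lower_half_def upper_half_def cover_edge_def)
  next
    case False
    then show ?thesis
      by (cases "i \<in> Y"; cases "j \<in> Y")
        (simp_all add: lower_half_def upper_half_def cover_edge_def insert_commute)
  qed
qed

lemma projection_covers:
  assumes gen: "diamond_generating X S" and Y: "Y \<subseteq> X" and T: "diamond_closed Y T"
    and sub: "\<And>A B. (A, B) \<in> S \<Longrightarrow> A \<inter> Y = B \<inter> Y \<or> (A \<inter> Y, B \<inter> Y) \<in> T"
  shows "cover_edges Y \<subseteq> T"
proof
  fix e assume "e \<in> cover_edges Y"
  then obtain i A where e: "e = cover_edge i A" "i \<in> Y" "A \<subseteq> Y - {i}"
    unfolding cover_edges_def by blast
  let ?T = "{(A, B). A \<inter> Y = B \<inter> Y \<or> (A \<inter> Y, B \<inter> Y) \<in> T}"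
  have "S \<subseteq> ?T" using sub by auto
  then have "cover_edges X \<subseteq> ?T"
    using gen diamond_closed_projection[OF T] unfolding diamond_generating_iff by blast
  moreover have "cover_edge i A \<in> cover_edges X"
    using e Y by (intro cover_edge_in_cover_edges) auto
  ultimately have "cover_edge i A \<in> ?T" by (rule subsetD)
  moreover have "A \<inter> Y = A" "insert i A \<inter> Y = insert i A" "A \<noteq> insert i A" using e by auto
  ultimately show "e \<in> T" by (simp add: cover_edge_def e(1))
qed


section \<open>Every direction occurs in a generating set\<close>

text \<open>
  The lattice of \<open>{i}\<close> has one edge and no diamonds, so the empty set is closed in it and
  cannot be the projection of a generating set.
\<close>

lemma direction_needed:
  assumes gen: "diamond_generating X S" and i: "i \<in> X"
  shows "\<exists>A \<subseteq> X - {i}. cover_edge i A \<in> S"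
proof (rule ccontr)
  assume none: "\<not> ?thesis"
  have "A \<inter> {i} = B \<inter> {i}" if AB: "(A, B) \<in> S" for A B
  proof -
    have "(A, B) \<in> cover_edges X" using gen AB unfolding diamond_generating_def by blast
    then obtain k where "k \<in> X" "A \<subseteq> X - {k}" "(A, B) = cover_edge k A"
      unfolding cover_edges_def cover_edge_def by auto
    moreover from this have "k \<noteq> i" using none AB by metis
    ultimately show ?thesis unfolding cover_edge_def by auto
  qed
  moreover have "diamond_closed {i} {}"
    by (rule diamond_closedI) (auto simp: is_diamond_def)
  ultimately have "cover_edges {i} \<subseteq> {}"
    using projection_covers[OF gen, of "{i}" "{}"] i by auto
  moreover have "cover_edge i {} \<in> cover_edges {i}" by (rule cover_edge_in_cover_edges) auto
  ultimately show False by blast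
qed

lemma generating_contains_transversal:
  assumes gen: "diamond_generating X S"
  obtains N where "\<And>i. i \<in> X \<Longrightarrow> N i \<subseteq> X - {i}" "\<And>i. i \<in> X \<Longrightarrow> cover_edge i (N i) \<in> S"
proof -
  have "\<forall>i\<in>X. \<exists>A. A \<subseteq> X - {i} \<and> cover_edge i A \<in> S"
    using direction_needed[OF gen] by blast
  then show thesis using that by metis
qed

lemma card_transversal:
  assumes "\<And>i. i \<in> X \<Longrightarrow> N i \<subseteq> X - {i}"
  shows "card ((\<lambda>i. cover_edge i (N i)) ` X) = card X"
proof (rule card_image, rule inj_onI)
  fix i k assume ik: "i \<in> X" "k \<in> X" "cover_edge i (N i) = cover_edge k (N k)"
  moreover have "i \<notin> N i" "k \<notin> N k" using ik assms by blast+
  ultimately show "i = k" using cover_edge_eq_iff by metis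
qed

lemma finite_generating:
  assumes "finite X" "diamond_generating X S"
  shows "finite S"
proof (rule finite_subset)
  show "S \<subseteq> Pow X \<times> Pow X"
    using assms(2) unfolding diamond_generating_def cover_edges_def cover_edge_def by auto
qed (use assms in simp)

lemma card_le_card_generating:
  assumes "finite X" and gen: "diamond_generating X S"
  shows "card X \<le> card S"
proof -
  obtain N where N: "\<And>i. i \<in> X \<Longrightarrow> N i \<subseteq> X - {i}" "\<And>i. i \<in> X \<Longrightarrow> cover_edge i (N i) \<in> S"
    using generating_contains_transversal[OF gen] by blast
  show ?thesis
    using card_mono[OF finite_generating[OF assms], of "(\<lambda>i. cover_edge i (N i)) ` X"]
      card_transversal[of X N] N by auto
qed

lemma bottom_edges_generating:
  assumes "finite X"
  shows "diamond_generating X ((\<lambda>i. cover_edge i {}) ` X)"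
  unfolding diamond_generating_iff
  using bottom_edges_generate[OF assms] cover_edge_in_cover_edges[of _ X "{}"] by blast

text \<open>
  In the projection to \<open>{i, j}\<close>, failure of symmetry leaves only two edges, forming the chain
  \<open>{} \<rightarrow> {j} \<rightarrow> {i, j}\<close>; it contains neither half of the unique diamond, so it is closed.
\<close>

lemma minimal_generating_symmetric:
  assumes gen: "diamond_generating X ((\<lambda>i. cover_edge i (N i)) ` X)"
    and ij: "i \<in> X" "j \<in> X" and j: "j \<in> N i"
  shows "i \<in> N j"
proof (rule ccontr)
  assume n: "i \<notin> N j"
  have N: "k \<notin> N k" if "k \<in> X" for k
  proof -
    have "cover_edge k (N k) \<in> cover_edges X"
      using gen that unfolding diamond_generating_def by blast
    then show ?thesis unfolding cover_edges_def cover_edge_def by auto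
  qed
  have "i \<noteq> j" using N ij j by blast
  let ?T = "{cover_edge i {j}, cover_edge j {}}"
  have "cover_edges {i, j} \<subseteq> ?T"
  proof (rule projection_covers[OF gen])
    show "{i, j} \<subseteq> X" using ij by blast
    show "diamond_closed {i, j} ?T"
    proof (rule diamond_closedI)
      fix A k l assume "is_diamond {i, j} A k l"
      then have "A = {}" "k = i \<and> l = j \<or> k = j \<and> l = i"
        by (auto simp: is_diamond_def)
      with \<open>i \<noteq> j\<close> show "lower_half A k l \<subseteq> ?T \<longleftrightarrow> upper_half A k l \<subseteq> ?T"
        by (auto simp: lower_half_def upper_half_def cover_edge_def)
    qed
    show "A \<inter> {i, j} = B \<inter> {i, j} \<or> (A \<inter> {i, j}, B \<inter> {i, j}) \<in> ?T"
      if AB: "(A, B) \<in> (\<lambda>i. cover_edge i (N i)) ` X" for A B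
    proof -
      obtain k where k: "k \<in> X" "A = N k" "B = insert k (N k)"
        using AB by (auto simp: cover_edge_def)
      consider "k = i" | "k = j" | "k \<notin> {i, j}" by blast
      then show ?thesis
      proof cases
        case 1
        have "A \<inter> {i, j} = {j}" using k(2) 1 N[OF ij(1)] j by blast
        moreover have "B \<inter> {i, j} = insert i (A \<inter> {i, j})" using k 1 by blast
        ultimately show ?thesis by (simp add: cover_edge_def)
      next
        case 2
        have "A \<inter> {i, j} = {}" using k(2) 2 N[OF ij(2)] n by blast
        moreover have "B \<inter> {i, j} = insert j (A \<inter> {i, j})" using k 2 by blast
        ultimately show ?thesis by (simp add: cover_edge_def)
      next
        case 3
        then have "A \<inter> {i, j} = B \<inter> {i, j}" using k by blast
        then show ?thesis ..
      qed
    qed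
  qed
  moreover have "cover_edge i {} \<in> cover_edges {i, j}"
    by (rule cover_edge_in_cover_edges) auto
  ultimately show False using \<open>i \<noteq> j\<close> by (auto simp: cover_edge_def)
qed


section \<open>The edges of a cograph generate\<close>

lemma nbhd_subset: "pair_graph G \<Longrightarrow> nbhd G i \<subseteq> pverts G - {i}"
  unfolding pair_graph_iff nbhd_def irrefl_def by blast

lemma graph_edges_altdef: "graph_edges G = (\<lambda>i. cover_edge i (nbhd G i)) ` pverts G"
  unfolding graph_edges_def by blast

lemma nbhd_outside: "pair_graph G \<Longrightarrow> i \<notin> pverts G \<Longrightarrow> nbhd G i = {}"
  unfolding pair_graph_iff nbhd_def by blast

lemma graph_union_commute: "graph_union G H = graph_union H G"
  unfolding graph_union_def by (simp add: Un_commute)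

lemma graph_join_commute: "graph_join G H = graph_join H G"
  unfolding graph_join_def by (simp add: Un_ac)

lemma nbhd_union_left:
  assumes "pair_graph H" "i \<in> pverts G" "pverts G \<inter> pverts H = {}"
  shows "nbhd (graph_union G H) i = nbhd G i"
proof -
  have "nbhd (graph_union G H) i = nbhd G i \<union> nbhd H i"
    unfolding nbhd_def graph_union_def by auto
  then show ?thesis using nbhd_outside[OF assms(1), of i] assms by auto
qed

lemma nbhd_join_left:
  assumes "pair_graph H" "i \<in> pverts G" "pverts G \<inter> pverts H = {}"
  shows "nbhd (graph_join G H) i = nbhd G i \<union> pverts H"
proof -
  have "nbhd (graph_join G H) i = nbhd G i \<union> nbhd H i \<union> pverts H"
    using assms(2,3) unfolding nbhd_def graph_join_def by auto
  then show ?thesis using nbhd_outside[OF assms(1), of i] assms by auto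
qed

text \<open>
  The edges of \<open>G\<close> generate the interval \<open>[{}, V(G)]\<close>, which contains the bottom edge
  of every direction in \<open>V(G)\<close>.
\<close>

lemma bottom_edge_union:
  assumes gen: "diamond_generating (pverts G) (graph_edges G)"
    and "pair_graph H" "pverts G \<inter> pverts H = {}"
    and T: "diamond_closed (pverts (graph_union G H)) T" "graph_edges (graph_union G H) \<subseteq> T"
    and i: "i \<in> pverts G"
  shows "cover_edge i {} \<in> T"
proof -
  have "cover_edge i ({} \<union> {}) \<in> T"
  proof (rule interval_generated[OF gen T(1)])
    fix A B assume "(A, B) \<in> graph_edges G"
    then obtain k where k: "k \<in> pverts G" "(A, B) = cover_edge k (nbhd G k)"
      unfolding graph_edges_altdef by blast
    then have "k \<in> pverts (graph_union G H)" by (simp add: graph_union_def)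
    then have "cover_edge k (nbhd (graph_union G H) k) \<in> T"
      using T(2) unfolding graph_edges_altdef by blast
    with k(2) show "(A \<union> {}, B \<union> {}) \<in> T"
      by (simp add: nbhd_union_left[OF assms(2) k(1) assms(3)])
  qed (use i in \<open>auto simp: graph_union_def\<close>)
  then show ?thesis by simp
qed

text \<open>
  In a join the edges of \<open>G\<close> are shifted by \<open>V(H)\<close>, so they generate the interval from
  \<open>V(H)\<close> to the top.
\<close>

lemma top_edge_join:
  assumes gen: "diamond_generating (pverts G) (graph_edges G)"
    and "pair_graph H" "pverts G \<inter> pverts H = {}"
    and T: "diamond_closed (pverts (graph_join G H)) T" "graph_edges (graph_join G H) \<subseteq> T"
    and i: "i \<in> pverts G"
  shows "cover_edge i (pverts (graph_join G H) - {i}) \<in> T"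
proof -
  have "cover_edge i ((pverts G - {i}) \<union> pverts H) \<in> T"
  proof (rule interval_generated[OF gen T(1)])
    fix A B assume "(A, B) \<in> graph_edges G"
    then obtain k where k: "k \<in> pverts G" "(A, B) = cover_edge k (nbhd G k)"
      unfolding graph_edges_altdef by blast
    then have "k \<in> pverts (graph_join G H)" by (simp add: graph_join_def)
    then have "cover_edge k (nbhd (graph_join G H) k) \<in> T"
      using T(2) unfolding graph_edges_altdef by blast
    then have "cover_edge k (nbhd G k \<union> pverts H) \<in> T"
      by (simp add: nbhd_join_left[OF assms(2) k(1) assms(3)])
    with k show "(A \<union> pverts H, B \<union> pverts H) \<in> T"
      by (simp add: cover_edge_def)
  qed (use i assms(3) in \<open>auto simp: graph_join_def\<close>)
  moreover have "(pverts G - {i}) \<union> pverts H = pverts (graph_join G H) - {i}"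
    using i assms(3) by (auto simp: graph_join_def)
  ultimately show ?thesis by simp
qed

lemma cograph_generating: "cograph G \<Longrightarrow> diamond_generating (pverts G) (graph_edges G)"
proof (induction rule: cograph.induct)
  case (single v)
  have "graph_edges \<lparr>pverts = {v}, parcs = {}\<rparr> = (\<lambda>i. cover_edge i {}) ` {v}"
    by (auto simp: graph_edges_def nbhd_def)
  then show ?case using bottom_edges_generating[of "{v}"] by simp
next
  case (union G H)
  let ?U = "graph_union G H"
  have pg: "pair_graph G" "pair_graph H" "pair_graph ?U"
    using union cograph.union cograph_pair_graph by blast+
  have "cover_edges (pverts ?U) \<subseteq> T"
    if T: "diamond_closed (pverts ?U) T" "graph_edges ?U \<subseteq> T" for T
  proof (rule bottom_edges_generate[OF _ T(1)])
    fix i assume "i \<in> pverts ?U"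
    then consider "i \<in> pverts G" | "i \<in> pverts H" by (auto simp: graph_union_def)
    then show "cover_edge i {} \<in> T"
    proof cases
      case 1
      then show ?thesis using bottom_edge_union[OF union.IH(1) pg(2) union.hyps(3) T] by simp
    next
      case 2
      then show ?thesis
        using bottom_edge_union[OF union.IH(2) pg(1)] union.hyps(3) T
        by (simp add: graph_union_commute[of G H] Int_commute)
    qed
  qed (use pg in \<open>simp add: pair_graph_iff\<close>)
  then show ?case
    using graph_edges_cover_edges[OF pg(3)] unfolding diamond_generating_iff by blast
next
  case (join G H)
  let ?J = "graph_join G H"
  have pg: "pair_graph G" "pair_graph H" "pair_graph ?J"
    using join cograph.join cograph_pair_graph by blast+
  have "cover_edges (pverts ?J) \<subseteq> T"
    if T: "diamond_closed (pverts ?J) T" "graph_edges ?J \<subseteq> T" for T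
  proof (rule top_edges_generate[OF _ T(1)])
    fix i assume "i \<in> pverts ?J"
    then consider "i \<in> pverts G" | "i \<in> pverts H" by (auto simp: graph_join_def)
    then show "cover_edge i (pverts ?J - {i}) \<in> T"
    proof cases
      case 1
      then show ?thesis using top_edge_join[OF join.IH(1) pg(2) join.hyps(3) T] by simp
    next
      case 2
      then show ?thesis
        using top_edge_join[OF join.IH(2) pg(1)] join.hyps(3) T
        by (simp add: graph_join_commute[of G H] Int_commute)
    qed
  qed (use pg in \<open>simp add: pair_graph_iff\<close>)
  then show ?case
    using graph_edges_cover_edges[OF pg(3)] unfolding diamond_generating_iff by blast
qed


section \<open>A generating graph is a cograph\<close>

definition add_twin :: "bool \<Rightarrow> 'a \<Rightarrow> 'a \<Rightarrow> 'a pair_pre_digraph \<Rightarrow> 'a pair_pre_digraph" where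
  "add_twin adj i j G = \<lparr>pverts = insert j (pverts G),
     parcs = parcs G \<union> {j} \<times> nbhd G i \<union> nbhd G i \<times> {j} \<union> (if adj then {(i, j), (j, i)} else {})\<rparr>"

lemma add_twin_union:
  assumes "pair_graph H" "i \<in> pverts G" "pverts G \<inter> pverts H = {}"
  shows "add_twin adj i j (graph_union G H) = graph_union (add_twin adj i j G) H"
  using nbhd_union_left[OF assms] by (auto simp: add_twin_def graph_union_def)

lemma add_twin_join:
  assumes "pair_graph H" "i \<in> pverts G" "pverts G \<inter> pverts H = {}"
  shows "add_twin adj i j (graph_join G H) = graph_join (add_twin adj i j G) H"
  using nbhd_join_left[OF assms] by (auto simp: add_twin_def graph_join_def)

text \<open>
  The twin can be added inside whichever part of a union or join contains \<open>i\<close>, down to the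
  single vertex \<open>i\<close>, where the two vertices form a union or a join.
\<close>

lemma cograph_add_twin:
  "cograph G \<Longrightarrow> i \<in> pverts G \<Longrightarrow> j \<notin> pverts G \<Longrightarrow> cograph (add_twin adj i j G)"
proof (induction rule: cograph.induct)
  case (single v)
  let ?one = "\<lambda>v. \<lparr>pverts = {v}, parcs = {}\<rparr>"
  have "add_twin adj i j (?one v) =
      (if adj then graph_join (?one i) (?one j) else graph_union (?one i) (?one j))"
    using single by (auto simp: add_twin_def graph_join_def graph_union_def nbhd_def)
  moreover have "cograph (graph_join (?one i) (?one j))" "cograph (graph_union (?one i) (?one j))"
    using single by (auto intro!: cograph.intros)
  ultimately show ?case by simp
next
  case (union G H)
  have V: "pverts (graph_union G H) = pverts G \<union> pverts H" by (simp add: graph_union_def)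
  have pv: "pverts (add_twin adj i j K) = insert j (pverts K)" for K :: "'a pair_pre_digraph"
    by (simp add: add_twin_def)
  show ?case
  proof (cases "i \<in> pverts G")
    case True
    have "cograph (graph_union (add_twin adj i j G) H)"
      using union V True by (intro cograph.union) (auto simp: pv)
    then show ?thesis
      using add_twin_union[OF cograph_pair_graph[OF union.hyps(2)] True union.hyps(3)] by simp
  next
    case False
    then have i: "i \<in> pverts H" using union V by auto
    have dis: "pverts H \<inter> pverts G = {}" using union by auto
    have "cograph (graph_union (add_twin adj i j H) G)"
      using union V i by (intro cograph.union) (auto simp: pv)
    then show ?thesis
      using add_twin_union[OF cograph_pair_graph[OF union.hyps(1)] i dis]
      by (simp add: graph_union_commute[of G H])
  qed
next
  case (join G H)
  have V: "pverts (graph_join G H) = pverts G \<union> pverts H" by (simp add: graph_join_def)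
  have pv: "pverts (add_twin adj i j K) = insert j (pverts K)" for K :: "'a pair_pre_digraph"
    by (simp add: add_twin_def)
  show ?case
  proof (cases "i \<in> pverts G")
    case True
    have "cograph (graph_join (add_twin adj i j G) H)"
      using join V True by (intro cograph.join) (auto simp: pv)
    then show ?thesis
      using add_twin_join[OF cograph_pair_graph[OF join.hyps(2)] True join.hyps(3)] by simp
  next
    case False
    then have i: "i \<in> pverts H" using join V by auto
    have dis: "pverts H \<inter> pverts G = {}" using join by auto
    have "cograph (graph_join (add_twin adj i j H) G)"
      using join V i by (intro cograph.join) (auto simp: pv)
    then show ?thesis
      using add_twin_join[OF cograph_pair_graph[OF join.hyps(1)] i dis]
      by (simp add: graph_join_commute[of G H])
  qed
qed

definition delete_vertex :: "'a \<Rightarrow> 'a pair_pre_digraph \<Rightarrow> 'a pair_pre_digraph" where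
  "delete_vertex j G = \<lparr>pverts = pverts G - {j}, parcs = {(u, v) \<in> parcs G. u \<noteq> j \<and> v \<noteq> j}\<rparr>"

lemma pair_graph_delete_vertex: "pair_graph G \<Longrightarrow> pair_graph (delete_vertex j G)"
  by (auto simp: pair_graph_iff delete_vertex_def sym_def irrefl_def)

lemma nbhd_delete_vertex: "i \<noteq> j \<Longrightarrow> nbhd (delete_vertex j G) i = nbhd G i - {j}"
  by (auto simp: nbhd_def delete_vertex_def)

text \<open>
  The edges of \<open>G\<close> with vertex \<open>j\<close> deleted are the projections of the edges of \<open>G\<close>
  in the directions other than \<open>j\<close>.
\<close>

lemma delete_vertex_generating:
  assumes pg: "pair_graph G" and gen: "diamond_generating (pverts G) (graph_edges G)"
  shows "diamond_generating (pverts (delete_vertex j G)) (graph_edges (delete_vertex j G))"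
proof -
  let ?H = "delete_vertex j G"
  have V: "pverts ?H = pverts G - {j}" by (simp add: delete_vertex_def)
  have "cover_edges (pverts ?H) \<subseteq> T"
    if T: "diamond_closed (pverts ?H) T" "graph_edges ?H \<subseteq> T" for T
  proof (rule projection_covers[OF gen _ T(1)])
    fix A B assume "(A, B) \<in> graph_edges G"
    then obtain k where k: "k \<in> pverts G" "A = nbhd G k" "B = insert k (nbhd G k)"
      by (auto simp: graph_edges_altdef cover_edge_def)
    show "A \<inter> pverts ?H = B \<inter> pverts ?H \<or> (A \<inter> pverts ?H, B \<inter> pverts ?H) \<in> T"
    proof (cases "k = j")
      case True
      then show ?thesis using k V by auto
    next
      case False
      then have "cover_edge k (nbhd ?H k) \<in> T"
        using T(2) k V by (auto simp: graph_edges_altdef)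
      moreover have "A \<inter> pverts ?H = nbhd ?H k"
        using nbhd_subset[OF pg, of k] nbhd_delete_vertex[OF False, of G] k V by auto
      moreover have "B \<inter> pverts ?H = insert k (A \<inter> pverts ?H)" using k V False by auto
      ultimately show ?thesis by (simp add: cover_edge_def)
    qed
  qed (simp add: V)
  then show ?thesis
    using graph_edges_cover_edges[OF pair_graph_delete_vertex[OF pg]]
    unfolding diamond_generating_iff by blast
qed

lemma add_twin_delete_vertex:
  assumes pg: "pair_graph G" and ij: "j \<in> pverts G" "i \<noteq> j"
    and twins: "nbhd G i - {j} = nbhd G j - {i}"
  shows "add_twin ((i, j) \<in> parcs G) i j (delete_vertex j G) = G"
proof -
  have sym: "(u, v) \<in> parcs G \<longleftrightarrow> (v, u) \<in> parcs G" for u v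
    using pg by (auto simp: pair_graph_iff sym_def)
  have irr: "(u, u) \<notin> parcs G" for u using pg by (auto simp: pair_graph_iff irrefl_def)
  have tw: "(i, v) \<in> parcs G \<longleftrightarrow> (j, v) \<in> parcs G" if "v \<noteq> i" "v \<noteq> j" for v
    using twins that unfolding nbhd_def by blast
  let ?H = "add_twin ((i, j) \<in> parcs G) i j (delete_vertex j G)"
  have "(u, v) \<in> parcs ?H \<longleftrightarrow> (u, v) \<in> parcs G" for u v
    using ij sym irr tw
    by (cases "u = j"; cases "v = j"; cases "u = i"; cases "v = i")
      (auto simp: add_twin_def delete_vertex_def nbhd_def)
  then have "parcs ?H = parcs G" by auto
  moreover have "pverts ?H = pverts G" using ij by (auto simp: add_twin_def delete_vertex_def)
  ultimately show ?thesis by simp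
qed

lemma graph_edges_cover_edge_iff:
  assumes "pair_graph G" "i \<notin> A"
  shows "cover_edge i A \<in> graph_edges G \<longleftrightarrow> i \<in> pverts G \<and> A = nbhd G i"
proof
  assume "cover_edge i A \<in> graph_edges G"
  then obtain k where k: "k \<in> pverts G" "cover_edge i A = cover_edge k (nbhd G k)"
    unfolding graph_edges_altdef by blast
  moreover have "k \<notin> nbhd G k" using nbhd_subset[OF assms(1)] by blast
  ultimately show "i \<in> pverts G \<and> A = nbhd G i" using cover_edge_eq_iff[OF assms(2)] by metis
qed (auto simp: graph_edges_altdef)

text \<open>
  With two vertices or more, the edges of \<open>G\<close> are not all cover edges, so some diamond has a half
  among them without being contained in them. A lower half means that \<open>i\<close> and \<open>j\<close> have
  equal open neighbourhoods, an upper half that they have equal closed neighbourhoods.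
\<close>

lemma generating_has_twins:
  assumes pg: "pair_graph G" and gen: "diamond_generating (pverts G) (graph_edges G)"
    and two: "a \<in> pverts G" "b \<in> pverts G" "a \<noteq> b"
  obtains i j where "i \<in> pverts G" "j \<in> pverts G" "i \<noteq> j" "nbhd G i - {j} = nbhd G j - {i}"
proof -
  have "\<not> cover_edges (pverts G) \<subseteq> graph_edges G"
  proof
    assume "cover_edges (pverts G) \<subseteq> graph_edges G"
    then have "cover_edge a {} \<in> graph_edges G" "cover_edge a {b} \<in> graph_edges G"
      using two cover_edge_in_cover_edges[of a "pverts G"] by blast+
    then show False using two by (simp add: graph_edges_cover_edge_iff[OF pg])
  qed
  then have "\<not> diamond_closed (pverts G) (graph_edges G)"
    using gen unfolding diamond_generating_iff by blast
  then obtain A i j where d: "is_diamond (pverts G) A i j"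
    and h: "lower_half A i j \<subseteq> graph_edges G \<or> upper_half A i j \<subseteq> graph_edges G"
    unfolding diamond_closed_def by blast
  have nin: "i \<notin> A" "j \<notin> A" "i \<noteq> j" "i \<in> pverts G" "j \<in> pverts G"
    using d by (auto simp: is_diamond_def)
  from h have "nbhd G i - {j} = nbhd G j - {i}"
  proof
    assume "lower_half A i j \<subseteq> graph_edges G"
    then have "A = nbhd G i" "A = nbhd G j"
      using nin by (auto simp: lower_half_def graph_edges_cover_edge_iff[OF pg])
    then show ?thesis using nin by auto
  next
    assume "upper_half A i j \<subseteq> graph_edges G"
    then have "insert j A = nbhd G i" "insert i A = nbhd G j"
      using nin by (auto simp: upper_half_def graph_edges_cover_edge_iff[OF pg])
    then show ?thesis using nin by auto
  qed
  then show thesis using that nin by blast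
qed

lemma generating_imp_cograph:
  assumes "pair_graph G" "pverts G \<noteq> {}" "diamond_generating (pverts G) (graph_edges G)"
  shows "cograph G"
  using assms
proof (induction "card (pverts G)" arbitrary: G rule: less_induct)
  case less
  note pg = less.prems(1)
  from less.prems(2) obtain v where v: "v \<in> pverts G" by blast
  show ?case
  proof (cases "pverts G = {v}")
    case True
    then have "parcs G = {}" using pg by (auto simp: pair_graph_iff irrefl_def)
    with True have "G = \<lparr>pverts = {v}, parcs = {}\<rparr>" by simp
    then show ?thesis using cograph.single by metis
  next
    case False
    then obtain w where "w \<in> pverts G" "v \<noteq> w" using v by blast
    then obtain i j where ij: "i \<in> pverts G" "j \<in> pverts G" "i \<noteq> j"
      and twins: "nbhd G i - {j} = nbhd G j - {i}"
      using generating_has_twins[OF pg less.prems(3) v] by blast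
    let ?H = "delete_vertex j G"
    have V: "pverts ?H = pverts G - {j}" by (simp add: delete_vertex_def)
    have "card (pverts ?H) < card (pverts G)"
      using pg ij(2) unfolding V pair_graph_iff by (metis card_Diff1_less)
    moreover have "pverts ?H \<noteq> {}" using V ij by auto
    ultimately have "cograph ?H"
      using less.hyps pair_graph_delete_vertex[OF pg] delete_vertex_generating[OF pg less.prems(3)]
      by blast
    then have "cograph (add_twin ((i, j) \<in> parcs G) i j ?H)"
      using V ij by (intro cograph_add_twin) simp_all
    then show ?thesis using add_twin_delete_vertex[OF pg ij(2,3) twins] by simp
  qed
qed


section \<open>Minimum generating sets\<close>

text \<open>
  A transversal of the directions has \<open>|X|\<close> edges, so it is all of \<open>S\<close>.
\<close>

lemma minimum_generating_is_graph_edges: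
  assumes fin: "finite X" and gen: "diamond_generating X S" and card: "card S = card X"
  obtains G where "pair_graph G" "pverts G = X" "S = graph_edges G"
proof -
  obtain N where N: "\<And>i. i \<in> X \<Longrightarrow> N i \<subseteq> X - {i}" "\<And>i. i \<in> X \<Longrightarrow> cover_edge i (N i) \<in> S"
    using generating_contains_transversal[OF gen] by blast
  have S: "(\<lambda>i. cover_edge i (N i)) ` X = S"
    using N card card_transversal[of X N] by (intro card_subset_eq finite_generating[OF fin gen]) auto
  define G where "G = \<lparr>pverts = X, parcs = {(i, j). i \<in> X \<and> j \<in> N i}\<rparr>"
  have "sym (parcs G)"
    using minimal_generating_symmetric[of X N] gen N(1) by (auto simp: S sym_def G_def)
  then have "pair_graph G"
    using fin N(1) by (auto simp: pair_graph_iff G_def irrefl_def)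
  moreover have "S = graph_edges G"
    by (auto simp: graph_edges_altdef nbhd_def G_def simp flip: S)
  ultimately show thesis using that by (simp add: G_def)
qed

lemma graph_edges_inject:
  assumes pg: "pair_graph G" "pair_graph H" and V: "pverts G = pverts H"
    and E: "graph_edges G = graph_edges H"
  shows "G = H"
proof -
  have nb: "nbhd G i = nbhd H i" for i
  proof (cases "i \<in> pverts G")
    case True
    have "i \<notin> nbhd G i" using nbhd_subset[OF pg(1)] by blast
    moreover have "cover_edge i (nbhd G i) \<in> graph_edges H"
      using True E by (auto simp: graph_edges_altdef)
    ultimately show ?thesis by (simp add: graph_edges_cover_edge_iff[OF pg(2)])
  next
    case False
    then show ?thesis using nbhd_outside pg V by metis
  qed
  have "(i, j) \<in> parcs G \<longleftrightarrow> (i, j) \<in> parcs H" for i j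
    using nb[of i] by (auto simp: nbhd_def)
  then have "parcs G = parcs H" by auto
  with V show ?thesis by simp
qed

theorem theorem1p1:
  fixes X :: "'a set"
  assumes "finite X" and "X \<noteq> {}"
  shows "((\<forall>S. diamond_generating X S \<longrightarrow> card X \<le> card S)
            \<and> (\<exists>S. diamond_generating X S \<and> card S = card X))
       \<and> (\<forall>G. pair_graph G \<and> pverts G = X \<longrightarrow>
            (diamond_generating X (graph_edges G) \<longleftrightarrow> cograph G))
       \<and> (\<forall>S. diamond_generating X S \<and> card S = card X \<longrightarrow>
            (\<exists>!G. cograph G \<and> pverts G = X \<and> S = graph_edges G))"
proof (intro conjI allI impI)
  show "card X \<le> card S" if "diamond_generating X S" for S
    using card_le_card_generating[OF assms(1) that] .
  show "\<exists>S. diamond_generating X S \<and> card S = card X"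
    using bottom_edges_generating[OF assms(1)] card_transversal[of X "\<lambda>_. {}"] by blast
  show ii: "diamond_generating X (graph_edges G) \<longleftrightarrow> cograph G"
    if "pair_graph G \<and> pverts G = X" for G
    using that assms(2) generating_imp_cograph[of G] cograph_generating[of G] by blast
  fix S assume S: "diamond_generating X S \<and> card S = card X"
  then obtain G where G: "pair_graph G" "pverts G = X" "S = graph_edges G"
    using minimum_generating_is_graph_edges[OF assms(1)] by metis
  then have "cograph G" using ii S by blast
  then show "\<exists>!G. cograph G \<and> pverts G = X \<and> S = graph_edges G"
    using G graph_edges_inject cograph_pair_graph by metis
qed

end
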